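(* For every integer $k\ge 1$, there are only finitely many (up to isomorphism) $k$-vertex-critical $(\text{co-gem}, \text{paw}+P_1)$-free graphs.
   Context: All graphs are finite and simple. $\chi(G)$ denotes the chromatic number of $G$. A graph $G$ is $k$-vertex-critical if $\chi(G)=k$ and $\chi(G-v)<k$ for every $v\in V(G)$. $P_n$ denotes the path on $n$ vertices and $G+H$ denotes the disjoint union of graphs $G$ and $H$. The co-gem is the graph $P_4+P_1$. The paw is the graph on four vertices obtained from a triangle by adding one new vertex adjacent to exactly one vertex of the triangle. A graph is $(H_1,\dots,H_m)$-free if none of $H_1,\dots,H_m$ is isomorphic to an induced subgraph of it. *)

theory Defs
  imports "Graph_Theory.Pair_Digraph" "Graph_Theory.Digraph_Isomorphism"
begin

text \<open>
  A finite simple graph is a \<^locale>\<open>pair_graph\<close>: a finite, loop-free, symmetric digraph whose arcs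
  are ordered pairs, so that each edge is represented by both of its orientations. The null graph
  is included. The projection \<^const>\<open>with_proj\<close> into general digraphs is inserted as a coercion.
\<close>

subsection \<open>Colourings\<close>

definition proper_colouring :: "('a, 'b) pre_digraph \<Rightarrow> nat \<Rightarrow> ('a \<Rightarrow> nat) \<Rightarrow> bool" where
  "proper_colouring G k c \<longleftrightarrow>
     (\<forall>v \<in> verts G. c v < k) \<and> (\<forall>(u, v) \<in> arcs_ends G. c u \<noteq> c v)"

definition colourable :: "('a, 'b) pre_digraph \<Rightarrow> nat \<Rightarrow> bool" where
  "colourable G k \<longleftrightarrow> (\<exists>c. proper_colouring G k c)"

definition chromatic_number :: "('a, 'b) pre_digraph \<Rightarrow> nat" where
  "chromatic_number G = (LEAST k. colourable G k)"

definition vertex_critical :: "nat \<Rightarrow> ('a, 'b) pre_digraph \<Rightarrow> bool" where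
  "vertex_critical k G \<longleftrightarrow>
     chromatic_number G = k \<and>
     (\<forall>v \<in> verts G. chromatic_number (pre_digraph.del_vert G v) < k)"

text \<open>The least element in the definition of \<^const>\<open>chromatic_number\<close> exists for finite simple graphs.\<close>

lemma (in pair_graph) colourable_chromatic_number: "colourable G (chromatic_number G)"
proof -
  obtain f :: "'a \<Rightarrow> nat" and n where f: "f ` pverts G = {i. i < n}" "inj_on f (pverts G)"
    using finite_imp_inj_to_nat_seg[OF pair_finite_verts] by blast
  have "proper_colouring G n f"
    unfolding proper_colouring_def
  proof (intro conjI ballI)
    fix v assume "v \<in> verts G"
    then show "f v < n" using f(1) by auto
  next
    fix e assume "e \<in> arcs_ends G"
    moreover obtain u v where e: "e = (u, v)" by (cases e)
    ultimately have "(u, v) \<in> parcs G" by simp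
    then have "u \<in> pverts G" "v \<in> pverts G" "u \<noteq> v"
      using wellformed' no_loops' by blast+
    then show "case e of (u, v) \<Rightarrow> f u \<noteq> f v"
      using f(2) e by (simp add: inj_on_eq_iff)
  qed
  then have "colourable G n"
    unfolding colourable_def by blast
  then show ?thesis
    unfolding chromatic_number_def by (rule LeastI)
qed

subsection \<open>Particular graphs\<close>

definition path_graph :: "nat \<Rightarrow> nat pair_pre_digraph" where
  "path_graph n =
     \<lparr> pverts = {..<n}, parcs = {(i, j). i < n \<and> j < n \<and> (j = Suc i \<or> i = Suc j)} \<rparr>"

definition disjoint_union ::
  "'a pair_pre_digraph \<Rightarrow> 'b pair_pre_digraph \<Rightarrow> ('a + 'b) pair_pre_digraph" where
  "disjoint_union G H =
     \<lparr> pverts = pverts G <+> pverts H,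
       parcs = map_prod Inl Inl ` parcs G \<union> map_prod Inr Inr ` parcs H \<rparr>"

definition co_gem :: "(nat + nat) pair_pre_digraph" where
  "co_gem = disjoint_union (path_graph 4) (path_graph 1)"

definition paw :: "nat pair_pre_digraph" where
  "paw = (let E = {(0, 1), (1, 2), (0, 2), (2, 3)}
          in \<lparr> pverts = {0, 1, 2, 3}, parcs = E \<union> E\<inverse> \<rparr>)"

lemma pair_graph_path_graph: "pair_graph (path_graph n)"
proof
  show "finite (parcs (path_graph n))"
    by (rule finite_subset[of _ "{..<n} \<times> {..<n}"]) (auto simp: path_graph_def)
qed (auto simp: path_graph_def symmetric_def sym_def)

lemma pair_graph_paw: "pair_graph paw"
proof
  show "symmetric paw"
    unfolding symmetric_def by (simp add: paw_def Let_def sym_def)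
qed (auto simp: paw_def Let_def)

lemma sym_map_prod:
  assumes "sym r"
  shows "sym (map_prod f f ` r)"
proof (rule symI)
  fix a b assume "(a, b) \<in> map_prod f f ` r"
  then obtain u v where "(u, v) \<in> r" "a = f u" "b = f v" by auto
  then show "(b, a) \<in> map_prod f f ` r"
    using symD[OF assms] by (intro image_eqI[of _ _ "(v, u)"]) auto
qed

lemma pair_graph_disjoint_union:
  assumes "pair_graph G" "pair_graph H"
  shows "pair_graph (disjoint_union G H)"
proof -
  interpret G: pair_graph G by fact
  interpret H: pair_graph H by fact
  have "sym (parcs G)" "sym (parcs H)"
    using G.pair_sym_arcs H.pair_sym_arcs by (auto simp: symmetric_def)
  then have "symmetric (disjoint_union G H)"
    by (auto simp: symmetric_def disjoint_union_def intro!: sym_Un sym_map_prod)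
  then show ?thesis
    by unfold_locales
       (auto simp: disjoint_union_def dest: G.wellformed' H.wellformed' G.no_loops' H.no_loops')
qed

subsection \<open>Forbidden induced subgraphs and isomorphism classes\<close>

definition graph_free :: "'h pair_pre_digraph \<Rightarrow> 'a pair_pre_digraph \<Rightarrow> bool" where
  "graph_free H G \<longleftrightarrow> \<not> (\<exists>K :: 'a pair_pre_digraph. induced_subgraph K G \<and> digraph_iso H K)"

definition graph_iso_rel :: "'a pair_pre_digraph rel" where
  "graph_iso_rel = {(G, H). pair_graph G \<and> pair_graph H \<and> digraph_iso G H}"

end

theory Submission
  imports Defs
begin

text \<open>
  Let \<open>S\<close> be a maximum independent set of a \<open>k\<close>-vertex-critical graph with the two forbidden subgraphs,
  and suppose that \<open>card S \<ge> 3\<close>. The non-neighbours of any \<open>s \<in> S\<close> induce a graph without \<open>P\<^sub>4\<close> and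
  paw, which forces any two traces \<open>N(x) \<inter> S\<close>, \<open>N(y) \<inter> S\<close> to be equal, disjoint or to cover \<open>S\<close>.
  Criticality makes the neighbourhoods of the elements of \<open>S\<close> pairwise incomparable, so the traces
  other than \<open>S\<close> separate points, and therefore all of them are singletons or all of them are
  complements of singletons. In the first case the graph is the join of the vertices complete to \<open>S\<close>
  with a disconnected graph, and a component of the latter can be recoloured with the colours of
  another one, contradicting criticality. In the second case a \<open>(k - 1)\<close>-colouring of \<open>G - s\<close> is
  injective on the rest of \<open>S\<close>, so \<open>card S \<le> k\<close>. Since \<open>G - v\<close> is a union of \<open>k - 1\<close>
  independent sets, the number of vertices is bounded in terms of \<open>k\<close>.
\<close>

section \<open>Isomorphism of pair digraphs\<close>

lemma digraph_iso_with_projI: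
  assumes "pair_wf_digraph G" "inj_on f (pverts G)"
    and "pverts H = f ` pverts G" "parcs H = map_prod f f ` parcs G"
  shows "digraph_iso (with_proj G) (with_proj H)"
proof -
  interpret pair_wf_digraph G by fact
  let ?h = "\<lparr> iso_verts = f, iso_arcs = map_prod f f, iso_head = snd, iso_tail = fst \<rparr>"
  have "inj_on (map_prod f f) (parcs G)"
    by (intro inj_on_subset[OF map_prod_inj_on[OF assms(2) assms(2)]]) (auto dest: wellformed')
  then have "pre_digraph.digraph_isomorphism (with_proj G) ?h"
    using assms(1,2) by (simp add: pre_digraph.digraph_isomorphism_def wf_digraph_wp_iff)
  moreover have "with_proj H = app_iso ?h (with_proj G)"
    using assms(3,4) by (simp add: with_proj_def app_iso_def)
  ultimately show ?thesis
    unfolding digraph_iso_def by blast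
qed

text \<open>Every such graph has a copy on an initial segment of the naturals below
  \<open>N\<close>, and only finitely many graphs live there. This works for any vertex type, even
  an infinite one.\<close>

lemma finite_iso_classes:
  fixes A :: "'a pair_pre_digraph set"
  assumes graphs: "\<And>G. G \<in> A \<Longrightarrow> pair_graph G"
    and bound: "\<And>G. G \<in> A \<Longrightarrow> card (pverts G) \<le> N"
  shows "finite (A // graph_iso_rel)"
proof (rule finite_subset)
  let ?U = "{K :: nat pair_pre_digraph. pverts K \<subseteq> {..<N} \<and> parcs K \<subseteq> {..<N} \<times> {..<N}}"
  \<comment> \<open>Membership in \<open>A\<close> is not demanded: the quotient consists of full
    relation images, which may leave \<open>A\<close>.\<close>
  let ?cls = "\<lambda>K :: nat pair_pre_digraph. {H :: 'a pair_pre_digraph. pair_graph H \<and> digraph_iso K H}"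
  have "?U \<subseteq> (\<lambda>(V, E). \<lparr> pverts = V, parcs = E \<rparr>) ` (Pow {..<N} \<times> Pow ({..<N} \<times> {..<N}))"
  proof
    fix K assume "K \<in> ?U"
    then show "K \<in> (\<lambda>(V, E). \<lparr> pverts = V, parcs = E \<rparr>) ` (Pow {..<N} \<times> Pow ({..<N} \<times> {..<N}))"
      by (intro image_eqI[of _ _ "(pverts K, parcs K)"]) auto
  qed
  then have "finite ?U"
    by (rule finite_subset) simp
  then show "finite (?cls ` ?U)"
    by simp
  show "A // graph_iso_rel \<subseteq> ?cls ` ?U"
  proof
    fix X assume "X \<in> A // graph_iso_rel"
    then obtain G where G: "G \<in> A" "X = graph_iso_rel `` {G}"
      by (auto elim: quotientE)
    interpret pair_graph G using graphs G(1) .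
    obtain f :: "'a \<Rightarrow> nat" and n where f: "f ` pverts G = {i. i < n}" "inj_on f (pverts G)"
      using finite_imp_inj_to_nat_seg[OF pair_finite_verts] by blast
    have "n = card (pverts G)"
      using card_image[OF f(2)] f(1) by simp
    then have "n \<le> N"
      using bound G(1) by simp
    let ?K = "\<lparr> pverts = f ` pverts G, parcs = map_prod f f ` parcs G \<rparr>"
    have iso: "digraph_iso G ?K"
      by (rule digraph_iso_with_projI[OF _ f(2)]) (auto intro: pair_wf_digraph)
    have "f v < N" if "v \<in> pverts G" for v
    proof -
      have "f v \<in> {i. i < n}"
        using that f(1) by blast
      then show ?thesis
        using \<open>n \<le> N\<close> by simp
    qed
    then have "?K \<in> ?U"
      by (auto dest: wellformed')
    moreover have "X = ?cls ?K"
    proof -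
      have "digraph_iso G H \<longleftrightarrow> digraph_iso ?K H" for H :: "'a pair_pre_digraph"
        using digraph_iso_trans[OF iso, of H] digraph_iso_trans[OF digraph_iso_swap[OF wf_digraph iso], of H]
        by blast
      then show ?thesis
        using G(2) graphs[OF G(1)] by (auto simp: graph_iso_rel_def)
    qed
    ultimately show "X \<in> ?cls ` ?U" by blast
  qed
qed

section \<open>Forbidden configurations\<close>

text \<open>Since \<open>adj\<close> is an equivalence, the image of \<open>H\<close> under
  \<open>f\<close> carries all arcs of \<open>G\<close> between its vertices, so it is an induced
  copy. Finding a forbidden subgraph thus becomes a finite adjacency check.\<close>

lemma (in pair_wf_digraph) graph_freeD:
  assumes free: "graph_free H G" and H: "pair_wf_digraph H"
    and inj: "inj_on f (pverts H)" and sub: "f ` pverts H \<subseteq> pverts G"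
    and adj: "\<And>u v. u \<in> pverts H \<Longrightarrow> v \<in> pverts H \<Longrightarrow> (u, v) \<in> parcs H \<longleftrightarrow> (f u, f v) \<in> parcs G"
  shows False
proof -
  interpret H: pair_wf_digraph H by fact
  let ?K = "\<lparr> pverts = f ` pverts H, parcs = map_prod f f ` parcs H \<rparr>"
  have arcs: "parcs ?K = {e \<in> parcs G. fst e \<in> f ` pverts H \<and> snd e \<in> f ` pverts H}"
    using adj by (fastforce dest: H.wellformed' intro: rev_image_eqI)
  then have "pair_wf_digraph ?K"
    by unfold_locales auto
  then have "induced_subgraph ?K G"
    using arcs sub by (intro induced_subgraphI subgraphI) 
      (auto simp: wf_digraph_wp_iff compatible_def intro: pair_wf_digraph_axioms)
  moreover have "digraph_iso H ?K"
    by (rule digraph_iso_with_projI[OF H inj]) simp_all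
  ultimately show False
    using free by (auto simp: graph_free_def)
qed

context pair_graph
begin

text \<open>The path is \<open>a\<close>, \<open>b\<close>, \<open>c\<close>, \<open>d\<close> and
  the isolated vertex is \<open>s\<close>. Distinctness follows from the adjacency pattern and need
  not be assumed.\<close>

lemma co_gem_freeD:
  assumes free: "graph_free co_gem G" and "s \<in> pverts G"
    and "(a, b) \<in> parcs G" "(b, c) \<in> parcs G" "(c, d) \<in> parcs G"
    and "(a, c) \<notin> parcs G" "(a, d) \<notin> parcs G" "(b, d) \<notin> parcs G"
    and "(s, a) \<notin> parcs G" "(s, b) \<notin> parcs G" "(s, c) \<notin> parcs G" "(s, d) \<notin> parcs G"
  shows False
proof (rule graph_freeD[OF free])
  interpret co_gem: pair_graph co_gem
    unfolding co_gem_def by (intro pair_graph_disjoint_union pair_graph_path_graph)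
  show "pair_wf_digraph co_gem" ..
  let ?f = "case_sum (\<lambda>i. [a, b, c, d] ! i) (\<lambda>_. s)"
  have distinct: "distinct [a, b, c, d, s]"
    using assms arcs_symmetric no_loops' by auto
  have verts: "pverts co_gem = {Inl 0, Inl 1, Inl 2, Inl 3, Inr 0}"
    by (auto simp: co_gem_def disjoint_union_def path_graph_def Plus_def)
  have arcs: "parcs co_gem = {(Inl 0, Inl 1), (Inl 1, Inl 0), (Inl 1, Inl 2), (Inl 2, Inl 1),
      (Inl 2, Inl 3), (Inl 3, Inl 2)}"
  proof -
    have "parcs (path_graph 4) = {(0, 1), (1, 0), (1, 2), (2, 1), (2, 3), (3, 2)}"
      by (auto simp: path_graph_def)
    moreover have "parcs (path_graph 1) = {}"
      by (auto simp: path_graph_def)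
    ultimately show ?thesis
      by (simp add: co_gem_def disjoint_union_def)
  qed
  show "inj_on ?f (pverts co_gem)"
    using distinct unfolding verts by (auto simp: inj_on_def)
  show "?f ` pverts co_gem \<subseteq> pverts G"
    using assms unfolding verts by (auto dest: wellformed')
  have irrefl: "(x, x) \<notin> parcs G" for x
    using no_loops' by blast
  have sym: "(x, y) \<notin> parcs G \<Longrightarrow> (y, x) \<notin> parcs G" for x y
    using arcs_symmetric by blast
  show "(u, v) \<in> parcs co_gem \<longleftrightarrow> (?f u, ?f v) \<in> parcs G"
    if "u \<in> pverts co_gem" "v \<in> pverts co_gem" for u v
    using that unfolding verts arcs
    by (elim insertE emptyE)
      (simp_all add: irrefl assms(3-) assms(3-5)[THEN arcs_symmetric] assms(6-)[THEN sym])
qed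

text \<open>The triangle is \<open>a\<close>, \<open>b\<close>, \<open>c\<close>, the pendant vertex
  \<open>d\<close> hangs at \<open>c\<close>, and \<open>s\<close> is isolated.\<close>

lemma paw_P1_freeD:
  assumes free: "graph_free (disjoint_union paw (path_graph 1)) G" and "s \<in> pverts G"
    and "(a, b) \<in> parcs G" "(b, c) \<in> parcs G" "(a, c) \<in> parcs G" "(c, d) \<in> parcs G"
    and "(a, d) \<notin> parcs G" "(b, d) \<notin> parcs G"
    and "(s, a) \<notin> parcs G" "(s, b) \<notin> parcs G" "(s, c) \<notin> parcs G" "(s, d) \<notin> parcs G"
  shows False
proof (rule graph_freeD[OF free])
  let ?H = "disjoint_union paw (path_graph 1)"
  interpret H: pair_graph ?H
    by (intro pair_graph_disjoint_union pair_graph_path_graph pair_graph_paw)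
  show "pair_wf_digraph ?H" ..
  let ?f = "case_sum (\<lambda>i. [a, b, c, d] ! i) (\<lambda>_. s)"
  have distinct: "distinct [a, b, c, d, s]"
    using assms arcs_symmetric no_loops' by auto
  have verts: "pverts ?H = {Inl 0, Inl 1, Inl 2, Inl 3, Inr 0}"
    by (auto simp: disjoint_union_def path_graph_def paw_def Plus_def)
  have arcs: "parcs ?H = {(Inl 0, Inl 1), (Inl 1, Inl 0), (Inl 1, Inl 2), (Inl 2, Inl 1),
      (Inl 0, Inl 2), (Inl 2, Inl 0), (Inl 2, Inl 3), (Inl 3, Inl 2)}"
  proof -
    have "parcs paw = {(0, 1), (1, 0), (1, 2), (2, 1), (0, 2), (2, 0), (2, 3), (3, 2)}"
      by (auto simp: paw_def Let_def)
    moreover have "parcs (path_graph 1) = {}"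
      by (auto simp: path_graph_def)
    ultimately show ?thesis
      by (simp add: disjoint_union_def)
  qed
  show "inj_on ?f (pverts ?H)"
    using distinct unfolding verts by (auto simp: inj_on_def)
  show "?f ` pverts ?H \<subseteq> pverts G"
    using assms unfolding verts by (auto dest: wellformed')
  have irrefl: "(x, x) \<notin> parcs G" for x
    using no_loops' by blast
  have sym: "(x, y) \<notin> parcs G \<Longrightarrow> (y, x) \<notin> parcs G" for x y
    using arcs_symmetric by blast
  show "(u, v) \<in> parcs ?H \<longleftrightarrow> (?f u, ?f v) \<in> parcs G"
    if "u \<in> pverts ?H" "v \<in> pverts ?H" for u v
    using that unfolding verts arcs
    by (elim insertE emptyE)
      (simp_all add: irrefl assms(3-) assms(3-6)[THEN arcs_symmetric] assms(7-)[THEN sym])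
qed

definition independent :: "'a set \<Rightarrow> bool" where
  "independent S \<longleftrightarrow> S \<subseteq> pverts G \<and> (\<forall>s\<in>S. \<forall>t\<in>S. (s, t) \<notin> parcs G)"

end

section \<open>Adjacency rules among the non-neighbours of a vertex\<close>

locale co_gem_paw_P1_free_graph = pair_graph G for G :: "'a pair_pre_digraph" +
  assumes co_gem_free: "graph_free co_gem G"
    and paw_P1_free: "graph_free (disjoint_union paw (path_graph 1)) G"
begin

text \<open>If \<open>y\<close> missed \<open>u\<close>, the non-neighbours of \<open>s\<close>
  would contain a paw (triangle \<open>y\<close>, \<open>t\<close>, \<open>x\<close> with
  \<open>u\<close> pendant at \<open>x\<close>) when \<open>x\<close> and \<open>y\<close> are
  adjacent, and the path \<open>u\<close>, \<open>x\<close>, \<open>t\<close>, \<open>y\<close>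
  otherwise.\<close>

lemma adj_of_common_neighbour:
  assumes "s \<in> pverts G" "(s, t) \<notin> parcs G" "(s, u) \<notin> parcs G" "(s, x) \<notin> parcs G" "(s, y) \<notin> parcs G"
    and "(t, u) \<notin> parcs G" "(x, t) \<in> parcs G" "(x, u) \<in> parcs G" "(y, t) \<in> parcs G"
  shows "(y, u) \<in> parcs G"
proof (rule ccontr)
  assume yu: "(y, u) \<notin> parcs G"
  show False
  proof (cases "(x, y) \<in> parcs G")
    case True
    show False
      by (rule paw_P1_freeD[OF paw_P1_free, of s y t x u]) (use assms True yu arcs_symmetric in blast)+
  next
    case False
    show False
      by (rule co_gem_freeD[OF co_gem_free, of s u x t y]) (use assms False yu arcs_symmetric in blast)+
  qed
qed

text \<open>An edge between \<open>x\<close> and \<open>y\<close> would complete the induced path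
  \<open>t\<close>, \<open>x\<close>, \<open>y\<close>, \<open>u\<close> away from
  \<open>s\<close>.\<close>

lemma not_adj_of_private_neighbours:
  assumes "s \<in> pverts G" "(s, t) \<notin> parcs G" "(s, u) \<notin> parcs G" "(s, x) \<notin> parcs G" "(s, y) \<notin> parcs G"
    and "(t, u) \<notin> parcs G" "(x, t) \<in> parcs G" "(x, u) \<notin> parcs G" "(y, u) \<in> parcs G" "(y, t) \<notin> parcs G"
  shows "(x, y) \<notin> parcs G"
proof
  assume "(x, y) \<in> parcs G"
  show False
    by (rule co_gem_freeD[OF co_gem_free, of s t x y u])
      (use assms \<open>(x, y) \<in> parcs G\<close> arcs_symmetric in blast)+
qed

end

section \<open>Vertex-critical graphs\<close>

text \<open>Criticality in the form used for recolouring; \<open>m\<close> stands for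
  \<open>k - 1\<close>.\<close>

locale critical_graph = pair_graph G for G :: "'a pair_pre_digraph" +
  fixes m :: nat
  assumes not_colourable: "\<not> colourable G m"
    and colourable_del_vert: "v \<in> pverts G \<Longrightarrow> colourable (del_vert v) m"
begin

lemma not_proper:
  assumes "\<And>v. v \<in> pverts G \<Longrightarrow> c v < m" "\<And>u v. (u, v) \<in> parcs G \<Longrightarrow> c u \<noteq> c v"
  shows False
proof -
  have "proper_colouring G m c"
    using assms by (auto simp: proper_colouring_def)
  then show False
    using not_colourable by (auto simp: colourable_def)
qed

lemma obtain_colouring:
  assumes "v \<in> pverts G"
  obtains c where "\<And>u. u \<in> pverts G \<Longrightarrow> u \<noteq> v \<Longrightarrow> c u < m"
    "\<And>x y. (x, y) \<in> parcs G \<Longrightarrow> x \<noteq> v \<Longrightarrow> y \<noteq> v \<Longrightarrow> c x \<noteq> c y"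
proof -
  obtain c where c: "proper_colouring (del_vert v) m c"
    using colourable_del_vert[OF assms] by (auto simp: colourable_def)
  have "arcs_ends (del_vert v) = {(x, y) \<in> parcs G. x \<noteq> v \<and> y \<noteq> v}"
    by (auto simp: arcs_ends_conv del_vert_simps)
  then show ?thesis
    using c by (intro that[of c]) (auto simp: proper_colouring_def del_vert_simps)
qed

text \<open>A colour absent from the neighbours of \<open>v\<close> could be given to
  \<open>v\<close>, extending \<open>c\<close> to all of \<open>G\<close>.\<close>

lemma colour_in_neighbourhood:
  assumes v: "v \<in> pverts G"
    and c: "\<And>u. u \<in> pverts G \<Longrightarrow> u \<noteq> v \<Longrightarrow> c u < m"
      "\<And>x y. (x, y) \<in> parcs G \<Longrightarrow> x \<noteq> v \<Longrightarrow> y \<noteq> v \<Longrightarrow> c x \<noteq> c y"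
    and "i < m"
  shows "\<exists>u. (v, u) \<in> parcs G \<and> c u = i"
proof (rule ccontr)
  assume *: "\<not> ?thesis"
  show False
  proof (rule not_proper[of "c(v := i)"])
    show "(c(v := i)) u < m" if "u \<in> pverts G" for u
      using that c(1) \<open>i < m\<close> by simp
    show "(c(v := i)) x \<noteq> (c(v := i)) y" if "(x, y) \<in> parcs G" for x y
      using that c(2)[OF that] * no_loops'[OF that] arcs_symmetric[OF that] by auto
  qed
qed

text \<open>In a colouring of \<open>G - s\<close> the colour of \<open>t\<close> must recur on some
  neighbour of \<open>s\<close>, and a vertex coloured like \<open>t\<close> is not adjacent to
  \<open>t\<close>.\<close>

lemma neighbourhoods_incomparable:
  assumes "s \<in> pverts G" "t \<in> pverts G" "s \<noteq> t"
  shows "\<exists>x. (x, s) \<in> parcs G \<and> (x, t) \<notin> parcs G"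
proof -
  obtain c where c: "\<And>u. u \<in> pverts G \<Longrightarrow> u \<noteq> s \<Longrightarrow> c u < m"
    "\<And>x y. (x, y) \<in> parcs G \<Longrightarrow> x \<noteq> s \<Longrightarrow> y \<noteq> s \<Longrightarrow> c x \<noteq> c y"
    using obtain_colouring[OF assms(1)] by metis
  obtain u where "(s, u) \<in> parcs G" "c u = c t"
    using colour_in_neighbourhood[where c = c and i = "c t", OF assms(1) c] c(1) assms by blast
  then show ?thesis
    using c(2)[of u t] assms(3) no_loops' arcs_symmetric by metis
qed

text \<open>\<open>A\<close> and \<open>B\<close> have the same outside neighbours. Whichever of
  them needs no more colours than the other can be recoloured with colours of the other, which those
  outside neighbours avoid; this repairs the colouring at the deleted vertex.\<close>

lemma no_twin_modules:
  assumes A: "A \<subseteq> pverts G" "A \<noteq> {}" and B: "B \<subseteq> pverts G" "B \<noteq> {}" and disj: "A \<inter> B = {}"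
    and anti: "\<And>a b. a \<in> A \<Longrightarrow> b \<in> B \<Longrightarrow> (a, b) \<notin> parcs G"
    and mod: "\<And>x a b. x \<notin> A \<union> B \<Longrightarrow> a \<in> A \<union> B \<Longrightarrow> (x, a) \<in> parcs G \<Longrightarrow> b \<in> A \<union> B \<Longrightarrow> (x, b) \<in> parcs G"
  shows False
proof -
  obtain a b where ab: "a \<in> A" "b \<in> B"
    using A B by blast
  obtain c where c: "\<And>u. u \<in> pverts G \<Longrightarrow> u \<noteq> b \<Longrightarrow> c u < m"
    "\<And>x y. (x, y) \<in> parcs G \<Longrightarrow> x \<noteq> b \<Longrightarrow> y \<noteq> b \<Longrightarrow> c x \<noteq> c y"
    using obtain_colouring[of b] ab B by blast
  obtain d where d: "\<And>u. u \<in> pverts G \<Longrightarrow> u \<noteq> a \<Longrightarrow> d u < m"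
    "\<And>x y. (x, y) \<in> parcs G \<Longrightarrow> x \<noteq> a \<Longrightarrow> y \<noteq> a \<Longrightarrow> d x \<noteq> d y"
    using obtain_colouring[of a] ab A by blast
  \<comment> \<open>Stated for generic \<open>X\<close> and \<open>Y\<close>, to be used either way
    round according to whether \<open>d\<close> on \<open>B\<close> or \<open>c\<close> on
    \<open>A\<close> takes fewer colours.\<close>
  have swap: False
    if X: "X \<subseteq> pverts G" "x \<in> X" and Y: "Y \<subseteq> pverts G" "y \<in> Y" and "X \<inter> Y = {}"
      and anti: "\<And>x y. x \<in> X \<Longrightarrow> y \<in> Y \<Longrightarrow> (x, y) \<notin> parcs G"
      and mod: "\<And>z x y. z \<notin> X \<union> Y \<Longrightarrow> x \<in> X \<union> Y \<Longrightarrow> (z, x) \<in> parcs G \<Longrightarrow> y \<in> X \<union> Y \<Longrightarrow> (z, y) \<in> parcs G"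
      and c: "\<And>u. u \<in> pverts G \<Longrightarrow> u \<noteq> y \<Longrightarrow> c u < m"
        "\<And>u v. (u, v) \<in> parcs G \<Longrightarrow> u \<noteq> y \<Longrightarrow> v \<noteq> y \<Longrightarrow> c u \<noteq> c v"
      and d: "\<And>u. u \<in> pverts G \<Longrightarrow> u \<noteq> x \<Longrightarrow> d u < m"
        "\<And>u v. (u, v) \<in> parcs G \<Longrightarrow> u \<noteq> x \<Longrightarrow> v \<noteq> x \<Longrightarrow> d u \<noteq> d v"
      and le: "card (d ` Y) \<le> card (c ` X)"
    for X Y x y and c d :: "'a \<Rightarrow> nat"
  proof -
    have "finite (d ` Y)" "finite (c ` X)"
      using X Y finite_subset pair_finite_verts by blast+
    then obtain h where h: "h ` d ` Y \<subseteq> c ` X" "inj_on h (d ` Y)"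
      using card_le_inj[OF _ _ le] by blast
    \<comment> \<open>\<open>h\<close> renames the \<open>d\<close>-colours of \<open>Y\<close> to
      colours that \<open>c\<close> uses on \<open>X\<close>. The vertex \<open>y\<close>, where
      \<open>c\<close> is uncontrolled, lies in \<open>Y\<close> and so is coloured through
      \<open>d\<close>.\<close>
    define e where "e u = (if u \<in> Y then h (d u) else c u)" for u
    show False
    proof (rule not_proper[of e])
      have cX: "c u < m" if "u \<in> X" for u
        using that X Y c(1) \<open>X \<inter> Y = {}\<close> by blast
      have hd: "h (d u) \<in> c ` X" if "u \<in> Y" for u
        using that h(1) by blast
      then have "h (d u) < m" if "u \<in> Y" for u
        using that cX by fastforce
      then show "e u < m" if "u \<in> pverts G" for u
        using that c(1)[OF that] Y by (auto simp: e_def)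
      \<comment> \<open>A clash would give \<open>z\<close> the \<open>c\<close>-colour of some
        vertex of \<open>X\<close>, but \<open>mod\<close> makes \<open>z\<close> adjacent to all of
        \<open>X\<close>.\<close>
      have out: "c z \<noteq> h (d w)" if "(z, w) \<in> parcs G" "w \<in> Y" "z \<notin> Y" for z w
      proof
        assume eq: "c z = h (d w)"
        then obtain x' where x': "x' \<in> X" "c z = c x'"
          using hd[OF \<open>w \<in> Y\<close>] by auto
        have "z \<notin> X" using anti \<open>w \<in> Y\<close> \<open>(z, w) \<in> parcs G\<close> by blast
        then have "(z, x') \<in> parcs G"
          using mod \<open>w \<in> Y\<close> \<open>(z, w) \<in> parcs G\<close> \<open>z \<notin> Y\<close> x'(1) by blast
        then show False
          using c(2) x' Y \<open>X \<inter> Y = {}\<close> \<open>z \<notin> Y\<close> by blast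
      qed
      show "e u \<noteq> e v" if uv: "(u, v) \<in> parcs G" for u v
      proof (cases "u \<in> Y"; cases "v \<in> Y")
        assume "u \<in> Y" "v \<in> Y"
        then show ?thesis
          using d(2)[OF uv] h(2) X \<open>X \<inter> Y = {}\<close> by (auto simp: e_def inj_on_eq_iff)
      next
        assume "u \<in> Y" "v \<notin> Y"
        then show ?thesis
          using out[of v u] arcs_symmetric[OF uv] by (auto simp: e_def)
      next
        assume "u \<notin> Y" "v \<in> Y"
        then show ?thesis
          using out[OF uv] by (auto simp: e_def)
      next
        assume "u \<notin> Y" "v \<notin> Y"
        then show ?thesis
          using c(2)[OF uv] Y by (auto simp: e_def)
      qed
    qed
  qed
  show False
  proof (cases "card (d ` B) \<le> card (c ` A)")
    case True
    show False
      by (rule swap[of A a B b c d, OF A(1) ab(1) B(1) ab(2) disj anti mod c d True])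
  next
    case False
    then have le: "card (c ` A) \<le> card (d ` B)" by simp
    have anti': "(b, a) \<notin> parcs G" if "b \<in> B" "a \<in> A" for a b
      using anti[OF that(2,1)] arcs_symmetric by blast
    have mod': "(x, b) \<in> parcs G"
      if "x \<notin> B \<union> A" "a \<in> B \<union> A" "(x, a) \<in> parcs G" "b \<in> B \<union> A" for x a b
      using mod[of x a b] that by (simp add: Un_commute)
    have disj': "B \<inter> A = {}" using disj by blast
    show False
      by (rule swap[of B b A a d c, OF B(1) ab(2) A(1) ab(1) disj' anti' mod' d c le])
  qed
qed

text \<open>Deleting one vertex leaves \<open>m\<close> colour classes, each independent; the
  summand 1 is the deleted vertex.\<close>

lemma card_verts_le:
  assumes "\<And>S. independent S \<Longrightarrow> card S \<le> r"
  shows "card (pverts G) \<le> 1 + m * r"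
proof (cases "pverts G = {}")
  case False
  then obtain v where v: "v \<in> pverts G" by blast
  obtain c where c: "\<And>u. u \<in> pverts G \<Longrightarrow> u \<noteq> v \<Longrightarrow> c u < m"
    "\<And>x y. (x, y) \<in> parcs G \<Longrightarrow> x \<noteq> v \<Longrightarrow> y \<noteq> v \<Longrightarrow> c x \<noteq> c y"
    using obtain_colouring[OF v] by metis
  define I where "I i = {u \<in> pverts G - {v}. c u = i}" for i
  have "pverts G - {v} = (\<Union>i<m. I i)"
    using c(1) by (auto simp: I_def)
  then have "card (pverts G - {v}) \<le> (\<Sum>i<m. card (I i))"
    using card_UN_le[of "{..<m}" I] by simp
  also have "independent (I i)" for i
    using c(2) by (fastforce simp: independent_def I_def)
  then have "(\<Sum>i<m. card (I i)) \<le> (\<Sum>i<m. r)"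
    using assms by (intro sum_mono) blast
  finally show ?thesis
    using v by (simp add: card_Diff_singleton)
qed simp

end

text \<open>With \<open>k \<ge> 1\<close> the truncated difference \<open>k - 1\<close> is really
  below \<open>k\<close>, so minimality of the chromatic number excludes \<open>k - 1\<close>
  colours.\<close>

lemma (in pair_graph) critical_graphI:
  assumes crit: "vertex_critical k G" and "k \<ge> 1"
  shows "critical_graph G (k - 1)"
proof
  show "\<not> colourable G (k - 1)"
    using crit assms(2) not_less_Least[of "k - 1" "colourable G"]
    by (auto simp: vertex_critical_def chromatic_number_def)
next
  fix v assume v: "v \<in> pverts G"
  let ?n = "chromatic_number (del_vert v)"
  \<comment> \<open>\<open>LEAST\<close> is attained only if some colouring of the smaller graph
    exists; restricting one of \<open>G\<close> supplies it.\<close>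
  obtain c where "proper_colouring G (chromatic_number G) c"
    using colourable_chromatic_number by (auto simp: colourable_def)
  then have "proper_colouring (del_vert v) (chromatic_number G) c"
    by (auto simp: proper_colouring_def arcs_ends_conv del_vert_simps)
  then have "colourable (del_vert v) (chromatic_number G)"
    unfolding colourable_def by blast
  then have "colourable (del_vert v) ?n"
    unfolding chromatic_number_def[of "del_vert v"] by (rule LeastI)
  moreover have "?n \<le> k - 1"
    using crit v assms(2) by (auto simp: vertex_critical_def)
  ultimately show "colourable (del_vert v) (k - 1)"
    by (force simp: colourable_def proper_colouring_def)
qed

section \<open>Bounding the independence number\<close>

text \<open>A member with two points inside and two outside is refuted by the sets separating these
  pairs. The two remaining kinds cannot coexist once \<open>S\<close> has three points.\<close>

lemma singletons_or_cosingletons: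
  assumes cross: "\<And>X Y. X \<in> F \<Longrightarrow> Y \<in> F \<Longrightarrow> X = Y \<or> X \<inter> Y = {} \<or> X \<union> Y = S"
    and sub: "\<And>X. X \<in> F \<Longrightarrow> X \<subset> S \<and> X \<noteq> {}"
    and sep: "\<And>s t. s \<in> S \<Longrightarrow> t \<in> S \<Longrightarrow> s \<noteq> t \<Longrightarrow> \<exists>X\<in>F. s \<in> X \<and> t \<notin> X"
    and card: "card S \<ge> 3"
  shows "(\<forall>X\<in>F. \<exists>a. X = {a}) \<or> (\<forall>X\<in>F. \<exists>a\<in>S. X = S - {a})"
proof -
  have each: "(\<exists>a. X = {a}) \<or> (\<exists>a\<in>S. X = S - {a})" if X: "X \<in> F" for X
  proof (rule ccontr)
    assume neg: "\<not> ?thesis"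
    obtain t where t: "t \<in> X" using sub[OF X] by blast
    then obtain t' where t': "t' \<in> X" "t' \<noteq> t" using neg by blast
    obtain u where u: "u \<in> S" "u \<notin> X" using sub[OF X] by blast
    have "X \<noteq> S - {u}" using neg u by blast
    then obtain u' where u': "u' \<in> S" "u' \<notin> X" "u' \<noteq> u" using sub[OF X] u by blast
    have tS: "t \<in> S" "t' \<in> S" using sub[OF X] t t' by blast+
    \<comment> \<open>By \<open>cross\<close>, \<open>Y\<close> covers everything outside
      \<open>X\<close> and \<open>Z\<close> is disjoint from \<open>X\<close>. Then \<open>Y\<close>
      and \<open>Z\<close> share \<open>u\<close>, differ at \<open>u'\<close> and both miss
      \<open>t'\<close>.\<close>
    obtain Y where Y: "Y \<in> F" "t \<in> Y" "t' \<notin> Y" using sep[of t t'] tS t' by blast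
    obtain Z where Z: "Z \<in> F" "u \<in> Z" "u' \<notin> Z" using sep[of u u'] u u' by blast
    have XY: "X \<union> Y = S" using cross[OF X Y(1)] Y t t' by blast
    have XZ: "X \<inter> Z = {}" using cross[OF X Z(1)] Z u u' by blast
    have "u \<in> Y" "u' \<in> Y" using XY u u' by blast+
    moreover have "t' \<notin> Z" using XZ t' by blast
    ultimately show False
      using cross[OF Y(1) Z(1)] Y Z tS by blast
  qed
  \<comment> \<open>Otherwise both sets contain \<open>a\<close> and miss \<open>b\<close>, so
    \<open>cross\<close> makes them equal and \<open>S\<close> has only two points.\<close>
  have mixed: "a = b" if "{a} \<in> F" "S - {b} \<in> F" "b \<in> S" for a b
  proof (rule ccontr)
    assume "a \<noteq> b"
    have "a \<in> S" using sub[OF that(1)] by blast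
    then have "a \<in> {a} \<inter> (S - {b})" "b \<notin> {a} \<union> (S - {b})"
      using \<open>a \<noteq> b\<close> by blast+
    then have "S - {b} = {a}"
      using cross[OF that(1,2)] \<open>b \<in> S\<close> by (metis empty_iff)
    then have "S = {a, b}" using \<open>a \<in> S\<close> \<open>b \<in> S\<close> by blast
    then show False using card \<open>a \<noteq> b\<close> by simp
  qed
  show ?thesis
  proof (rule ccontr)
    assume neg: "\<not> ?thesis"
    obtain a b where ab: "{a} \<in> F" "S - {b} \<in> F" "b \<in> S"
      using neg each by metis
    then have "a = b" using mixed by blast
    have "card (S - {b}) \<ge> 2" using card ab(3) by simp
    then have "S - {b} \<noteq> {}" by (metis card.empty not_numeral_le_zero)
    then obtain c where c: "c \<in> S - {b}" by blast
    have "card (S - {b} - {c}) \<ge> 1" using \<open>card (S - {b}) \<ge> 2\<close> c by simp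
    then have "S - {b} - {c} \<noteq> {}" by (metis card.empty not_one_le_zero)
    then obtain d where d: "d \<in> S - {b} - {c}" by blast
    \<comment> \<open>A member separating \<open>c\<close> from \<open>d\<close> is
      \<open>{c}\<close> or \<open>S - {d}\<close>, and each clashes with \<open>mixed\<close>, as
      \<open>c\<close> and \<open>d\<close> differ from \<open>a = b\<close>.\<close>
    obtain Z where Z: "Z \<in> F" "c \<in> Z" "d \<notin> Z" using sep[of c d] c d by blast
    from each[OF Z(1)] show False
    proof
      assume "\<exists>e. Z = {e}"
      then have "{c} \<in> F" using Z by blast
      then show False using mixed[of c b] ab c by blast
    next
      assume "\<exists>e\<in>S. Z = S - {e}"
      then have "S - {d} \<in> F" using Z d by blast
      then show False using mixed[of a d] ab d \<open>a = b\<close> by blast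
    qed
  qed
qed

locale critical_co_gem_paw_P1_free_graph = critical_graph + co_gem_paw_P1_free_graph
begin

section \<open>Traces on a maximal independent set with at least three vertices\<close>

context
  fixes S
  assumes S: "independent S" and card_S: "card S \<ge> 3"
    and maximal: "\<And>x. x \<in> pverts G - S \<Longrightarrow> \<exists>s\<in>S. (x, s) \<in> parcs G"
begin

lemma
  shows S_verts: "S \<subseteq> pverts G"
    and S_indep: "s \<in> S \<Longrightarrow> t \<in> S \<Longrightarrow> (s, t) \<notin> parcs G"
  using S by (auto simp: independent_def)

lemma S_third: "\<exists>u\<in>S. u \<noteq> s \<and> u \<noteq> t"
proof (rule ccontr)
  assume "\<not> ?thesis"
  then have "S \<subseteq> {s, t}" by blast
  then have "card S \<le> card {s, t}" by (intro card_mono) simp_all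
  also have "\<dots> \<le> 2" by (simp add: card_insert_if)
  finally show False using card_S by simp
qed

definition trace :: "'a \<Rightarrow> 'a set" where
  "trace x = {s \<in> S. (x, s) \<in> parcs G}"

text \<open>An \<open>s\<close> in \<open>S\<close> outside both traces sees neither
  \<open>x\<close>, \<open>y\<close> nor the rest of \<open>S\<close>. If the traces share some
  \<open>t\<close>, \<open>adj_of_common_neighbour\<close> at \<open>s\<close> carries each element
  of one trace into the other.\<close>

lemma traces_cross:
  "trace x = trace y \<or> trace x \<inter> trace y = {} \<or> trace x \<union> trace y = S"
proof -
  have *: "trace x \<subseteq> trace y" if t: "t \<in> trace x \<inter> trace y" and s: "s \<in> S - (trace x \<union> trace y)" for x y t s
  proof
    fix u assume u: "u \<in> trace x"
    have "(y, u) \<in> parcs G"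
      by (rule adj_of_common_neighbour[of s t u x y])
        (use t s u S_verts S_indep arcs_symmetric in \<open>auto simp: trace_def\<close>)
    then show "u \<in> trace y" using u by (simp add: trace_def)
  qed
  show ?thesis
  proof (rule ccontr)
    assume neg: "\<not> ?thesis"
    then obtain t where "t \<in> trace x \<inter> trace y" by blast
    moreover obtain s where "s \<in> S - (trace x \<union> trace y)"
      using neg by (auto simp: trace_def)
    ultimately have "trace x = trace y"
      using *[of t x y s] *[of t y x s] by blast
    then show False using neg by blast
  qed
qed

text \<open>Maximality makes the traces nonempty, and incomparable neighbourhoods make those other
  than \<open>S\<close> separate points.\<close>

lemma traces_singletons_or_cosingletons:
  "(\<forall>x\<in>pverts G - S. trace x = S \<or> (\<exists>a. trace x = {a})) \<or>
   (\<forall>x\<in>pverts G - S. trace x = S \<or> (\<exists>a\<in>S. trace x = S - {a}))"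
proof -
  let ?F = "trace ` {x \<in> pverts G - S. trace x \<noteq> S}"
  have "(\<forall>X\<in>?F. \<exists>a. X = {a}) \<or> (\<forall>X\<in>?F. \<exists>a\<in>S. X = S - {a})"
  proof (rule singletons_or_cosingletons[OF _ _ _ card_S])
    show "X = Y \<or> X \<inter> Y = {} \<or> X \<union> Y = S" if "X \<in> ?F" "Y \<in> ?F" for X Y
      using that traces_cross by auto
    show "X \<subset> S \<and> X \<noteq> {}" if "X \<in> ?F" for X
      using that maximal by (fastforce simp: trace_def)
    show "\<exists>X\<in>?F. s \<in> X \<and> t \<notin> X" if st: "s \<in> S" "t \<in> S" "s \<noteq> t" for s t
    proof -
      obtain x where x: "(x, s) \<in> parcs G" "(x, t) \<notin> parcs G"
        using neighbourhoods_incomparable st S_verts by blast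
      have "x \<in> pverts G - S" using x(1) st(1) S_indep wellformed' by blast
      then show ?thesis
        using x st by (auto simp: trace_def)
    qed
  qed
  then show ?thesis by blast
qed

text \<open>In the singleton case the sets of vertices seeing only \<open>s\<close> (together with \<open>s\<close>) are modules of
  the graph with the same outside neighbours, namely the vertices complete to \<open>S\<close>.\<close>

lemma traces_not_singletons:
  assumes single: "\<And>x. x \<in> pverts G - S \<Longrightarrow> trace x = S \<or> (\<exists>a. trace x = {a})"
  shows False
proof -
  define C where "C s = insert s {x \<in> pverts G - S. trace x = {s}}" for s
  have C_adj: "x \<in> pverts G - S \<and> trace x = {s}" if "x \<in> C s" "x \<noteq> s" for x s
    using that by (auto simp: C_def)
  have C_trace: "(x, t) \<notin> parcs G" if "x \<in> C s" "s \<in> S" "t \<in> S" "t \<noteq> s" for x s t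
  proof (cases "x = s")
    case True
    then show ?thesis using that S_indep by blast
  next
    case False
    then have "t \<notin> trace x" using C_adj[OF that(1)] that(4) by simp
    then show ?thesis using that(3) by (simp add: trace_def)
  qed
  have disj: "C s \<inter> C t = {}" if "s \<in> S" "t \<in> S" "s \<noteq> t" for s t
    using that by (auto simp: C_def)
  have anti: "(x, y) \<notin> parcs G" if "s \<in> S" "t \<in> S" "s \<noteq> t" "x \<in> C s" "y \<in> C t" for s t x y
  proof (cases "x = s \<or> y = t")
    case True
    then show ?thesis
      using C_trace that arcs_symmetric by metis
  next
    case False
    then have xy: "trace x = {s}" "trace y = {t}"
      using C_adj that by blast+
    \<comment> \<open>\<open>r\<close> is the isolated vertex: an edge from \<open>x\<close> to
      \<open>y\<close> would yield the path \<open>s\<close>, \<open>x\<close>, \<open>y\<close>,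
      \<open>t\<close> away from it.\<close>
    obtain r where r: "r \<in> S" "r \<noteq> s" "r \<noteq> t" using S_third by blast
    have "s \<in> trace x" "t \<notin> trace x" "t \<in> trace y" "s \<notin> trace y"
      using xy that(3) by simp_all
    then have adj: "(x, s) \<in> parcs G" "(x, t) \<notin> parcs G" "(y, t) \<in> parcs G" "(y, s) \<notin> parcs G"
      using that(1,2) by (simp_all add: trace_def)
    show ?thesis
    proof (rule not_adj_of_private_neighbours[of r s t x y])
      show "r \<in> pverts G" using r(1) S_verts by blast
      show "(r, x) \<notin> parcs G" using C_trace[OF that(4,1) r(1,2)] arcs_symmetric by blast
      show "(r, y) \<notin> parcs G" using C_trace[OF that(5,2) r(1,3)] arcs_symmetric by blast
    qed (simp_all add: S_indep r that adj)
  qed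
  have full: "(f, b) \<in> parcs G" if f: "f \<in> pverts G - S" "trace f = S" and s: "s \<in> S" and b: "b \<in> C s" for f s b
  proof (rule ccontr)
    assume nb: "(f, b) \<notin> parcs G"
    \<comment> \<open>Here \<open>b\<close> itself is the isolated vertex. It misses
      \<open>f\<close>, \<open>t\<close>, \<open>u\<close> and a vertex \<open>y\<close> with trace
      \<open>{t}\<close>; since \<open>f\<close> sees both \<open>t\<close> and \<open>u\<close>, so
      would \<open>y\<close>.\<close>
    obtain t where t: "t \<in> S" "t \<noteq> s" using S_third by blast
    obtain u where u: "u \<in> S" "u \<noteq> s" "u \<noteq> t" using S_third by blast
    obtain y where y: "(y, t) \<in> parcs G" "(y, u) \<notin> parcs G"
      using neighbourhoods_incomparable t u S_verts by blast
    have yS: "y \<in> pverts G - S" using y t S_indep wellformed' by blast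
    have "t \<in> trace y" "u \<notin> trace y" using y t(1) by (simp_all add: trace_def)
    then have "trace y = {t}" using single[OF yS] u(1) by fastforce
    then have "y \<in> C t" using yS by (simp add: C_def)
    have "(y, u) \<in> parcs G"
    proof (rule adj_of_common_neighbour[of b t u f y])
      show "b \<in> pverts G" using b s S_verts by (auto simp: C_def)
      show "(b, y) \<notin> parcs G" using anti[OF s t(1) t(2)[symmetric] b \<open>y \<in> C t\<close>] .
      show "(b, f) \<notin> parcs G" using nb arcs_symmetric by blast
      show "(b, t) \<notin> parcs G" "(b, u) \<notin> parcs G"
        using C_trace[OF b s t] C_trace[OF b s u(1,2)] .
      show "(f, t) \<in> parcs G" "(f, u) \<in> parcs G"
        using t(1) u(1) f(2) unfolding trace_def by blast+
    qed (simp_all add: S_indep t u y)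
    then show False using y by blast
  qed
  obtain s where s: "s \<in> S" using S_third by blast
  obtain t where t: "t \<in> S" "t \<noteq> s" using S_third by blast
  \<comment> \<open>An outside vertex with a neighbour in one of the two modules is neither in
    \<open>S\<close> nor in any \<open>C r\<close>, hence complete to \<open>S\<close>, and
    \<open>full\<close> applies.\<close>
  have out: "(x, b) \<in> parcs G"
    if x: "x \<notin> C s \<union> C t" and a: "a \<in> C p" "(x, a) \<in> parcs G" and b: "b \<in> C q"
      and pq: "p \<in> {s, t}" "q \<in> {s, t}" for x a b p q
  proof -
    have "p \<in> S" "q \<in> S" using pq s t by blast+
    have xp: "x \<notin> C p" using x pq by blast
    have "x \<notin> S"
    proof
      assume "x \<in> S"
      then have "x \<noteq> p" using xp by (auto simp: C_def)
      then show False
        using C_trace[OF a(1) \<open>p \<in> S\<close> \<open>x \<in> S\<close>] a(2) arcs_symmetric by blast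
    qed
    then have xS: "x \<in> pverts G - S" using a(2) wellformed' by blast
    have "trace x = S"
    proof (rule ccontr)
      assume "trace x \<noteq> S"
      then obtain r where r: "trace x = {r}" using single[OF xS] by blast
      then have "r \<in> S" "x \<in> C r" using xS by (auto simp: C_def trace_def)
      then show False
        using anti[of r p x a] \<open>p \<in> S\<close> a xp by blast
    qed
    then show ?thesis
      using full[OF xS _ \<open>q \<in> S\<close> b] by blast
  qed
  show False
  proof (rule no_twin_modules[of "C s" "C t"])
    show "C s \<subseteq> pverts G" "C t \<subseteq> pverts G" using s t S_verts by (auto simp: C_def)
    show "C s \<noteq> {}" "C t \<noteq> {}" by (auto simp: C_def)
    show "C s \<inter> C t = {}" using disj s t by blast
    show "(a, b) \<notin> parcs G" if "a \<in> C s" "b \<in> C t" for a b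
      using anti[OF s t(1) t(2)[symmetric] that] .
    show "(x, b) \<in> parcs G"
      if x: "x \<notin> C s \<union> C t" "(x, a) \<in> parcs G" and ab: "a \<in> C s \<union> C t" "b \<in> C s \<union> C t" for x a b
    proof -
      obtain p q where "a \<in> C p" "p \<in> {s, t}" "b \<in> C q" "q \<in> {s, t}"
        using ab by blast
      then show ?thesis
        using out[OF x(1) _ x(2)] by blast
    qed
  qed
qed

text \<open>If every other vertex misses at most one element of \<open>S\<close>, a colour used twice on \<open>S\<close> is used
  only on \<open>S\<close>, so it is available for every vertex of \<open>S\<close>.\<close>

lemma card_le_of_cosingleton_traces:
  assumes co: "\<And>x. x \<in> pverts G - S \<Longrightarrow> trace x = S \<or> (\<exists>a\<in>S. trace x = S - {a})"
  shows "card S \<le> Suc m"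
proof -
  obtain s where s: "s \<in> S" using S_third by blast
  then have sG: "s \<in> pverts G" using S_verts by blast
  obtain c where c: "\<And>u. u \<in> pverts G \<Longrightarrow> u \<noteq> s \<Longrightarrow> c u < m"
    "\<And>x y. (x, y) \<in> parcs G \<Longrightarrow> x \<noteq> s \<Longrightarrow> y \<noteq> s \<Longrightarrow> c x \<noteq> c y"
    using obtain_colouring[OF sG] by metis
  have "inj_on c (S - {s})"
  proof (rule inj_onI, rule ccontr)
    fix t u assume tu: "t \<in> S - {s}" "u \<in> S - {s}" "c t = c u" "t \<noteq> u"
    have "c t < m" using c(1) tu S_verts by blast
    \<comment> \<open>The colour shared by \<open>t\<close> and \<open>u\<close> recurs on a
      neighbour \<open>x\<close> of \<open>s\<close> outside \<open>S\<close>, which misses at most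
      one of \<open>t\<close> and \<open>u\<close>.\<close>
    then obtain x where x: "(s, x) \<in> parcs G" "c x = c t"
      using colour_in_neighbourhood[where c = c, OF sG c] by blast
    have xS: "x \<in> pverts G - S" using x s S_indep wellformed' by blast
    have "t \<in> trace x \<or> u \<in> trace x" using co[OF xS] tu by blast
    then have "(x, t) \<in> parcs G \<or> (x, u) \<in> parcs G" by (auto simp: trace_def)
    then show False using c(2) x tu xS s by (metis DiffD2 insertI1)
  qed
  moreover have "c ` (S - {s}) \<subseteq> {..<m}" using c(1) S_verts by blast
  ultimately have "card (S - {s}) \<le> m"
    using card_inj_on_le[of c "S - {s}" "{..<m}"] by simp
  then show ?thesis using s by (simp add: card_Diff_singleton)
qed

lemma card_maximal_independent_le: "card S \<le> Suc m"
  using traces_singletons_or_cosingletons traces_not_singletons card_le_of_cosingleton_traces by blast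

end

text \<open>A maximum independent set is also maximal under inclusion, so the bound for maximal sets
  applies to it.\<close>

lemma card_independent_le:
  assumes "independent S"
  shows "card S \<le> m + 2"
proof -
  have bounded: "card T \<le> card (pverts G)" if "independent T" for T
    using that pair_finite_verts by (auto simp: independent_def intro: card_mono)
  obtain T where T: "independent T" and max: "\<And>U. independent U \<Longrightarrow> card U \<le> card T"
    using ex_has_greatest_nat[of independent S card "Suc (card (pverts G))"] assms bounded
    by (metis less_Suc_eq_le)
  have fin: "finite T" using T finite_subset[OF _ pair_finite_verts] by (simp add: independent_def)
  \<comment> \<open>The slack over \<open>Suc m\<close> covers sets with at most two vertices:
    exceeding \<open>m + 2\<close> forces at least three, even for \<open>m = 0\<close>.\<close>
  have "card T \<le> m + 2"
  proof (rule ccontr)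
    assume "\<not> ?thesis"
    then have large: "card T > m + 2" by simp
    have "card T \<le> Suc m"
    proof (rule card_maximal_independent_le[OF T])
      show "3 \<le> card T" using large by simp
      fix x assume x: "x \<in> pverts G - T"
      show "\<exists>s\<in>T. (x, s) \<in> parcs G"
      proof (rule ccontr)
        assume "\<not> ?thesis"
        then have "independent (insert x T)"
          using T x arcs_symmetric no_loops'[of x x] by (auto simp: independent_def)
        then have "card (insert x T) \<le> card T" by (rule max)
        then show False using x fin by simp
      qed
    qed
    then show False using large by simp
  qed
  then show ?thesis using max[OF assms] by simp
qed

end

theorem theorem4p1:
  fixes k :: nat
  assumes "k \<ge> 1"
  shows "finite
    ({G :: 'a pair_pre_digraph. pair_graph G \<and> vertex_critical k G \<and>
        graph_free co_gem G \<and> graph_free (disjoint_union paw (path_graph 1)) G}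
     // graph_iso_rel)"
proof (rule finite_iso_classes)
  fix G :: "'a pair_pre_digraph"
  assume G: "G \<in> {G. pair_graph G \<and> vertex_critical k G \<and>
        graph_free co_gem G \<and> graph_free (disjoint_union paw (path_graph 1)) G}"
  then show "pair_graph G" by blast
  then interpret pair_graph G .
  interpret critical_graph G "k - 1"
    using critical_graphI G assms by blast
  interpret critical_co_gem_paw_P1_free_graph G "k - 1"
    using G by unfold_locales blast+
  \<comment> \<open>One deleted vertex plus \<open>k - 1\<close> colour classes of at most
    \<open>(k - 1) + 2\<close> vertices each.\<close>
  show "card (pverts G) \<le> 1 + (k - 1) * (k - 1 + 2)"
    using card_verts_le card_independent_le by blast
qed

end
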